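(* Let $G$ be a non-periodic group. Then the following conditions are equivalent: (i) $G$ is a BCI-group. (ii) There exists $n\in\mathbb{N}$ such that $|C_G(x)|\le n$ for every $x \in G$ such that $\langle x\rangle$ is not normal in $G$. (iii) Either $G$ is abelian or $G=\langle g,A\rangle$, where $A$ is a non-periodic abelian group of finite $2$-rank and $g$ is an element of order at most $4$ such that $g^2\in A$ and $a^g=a^{-1}$ for all $a\in A$.
   Context: A group $G$ is a BCI-group if there exists a positive integer $n$ such that $|C_G(x):\langle x\rangle|\le n$ for every $x\in G$ such that $\langle x\rangle$ is not normal in $G$. The $2$-rank of an abelian group $A$ is the dimension, over the field with $2$ elements, of the subgroup $\{a\in A\mid a^2=1\}$. A group is non-periodic if it has an element of infinite order. Notation: $a^g=g^{-1}ag$. *)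

theory Defs
  imports
    "HOL-Algebra.Algebra"
    "HOL-Number_Theory.Residues"
    "HOL-Library.Extended_Nat"
    "Jordan_Normal_Form.Missing_VectorSpace"
begin

text \<open>In HOL-Algebra, \<open>group.ord G x = 0\<close> if and only if \<open>x\<close> has infinite order.\<close>

definition non_periodic :: "('a, 'b) monoid_scheme \<Rightarrow> bool" where
  "non_periodic G \<longleftrightarrow> (\<exists>x\<in>carrier G. group.ord G x = 0)"

definition centralizer :: "('a, 'b) monoid_scheme \<Rightarrow> 'a \<Rightarrow> 'a set" where
  "centralizer G x = {y \<in> carrier G. y \<otimes>\<^bsub>G\<^esub> x = x \<otimes>\<^bsub>G\<^esub> y}"

text \<open>Since \<open>card\<close> is 0 on infinite sets, finiteness of the index is required explicitly.\<close>

definition bci_group :: "('a, 'b) monoid_scheme \<Rightarrow> bool" where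
  "bci_group G \<longleftrightarrow> group G \<and>
     (\<exists>n::nat. n > 0 \<and>
       (\<forall>x\<in>carrier G. \<not> (generate G {x} \<lhd> G) \<longrightarrow>
          finite (rcosets\<^bsub>G\<lparr>carrier := centralizer G x\<rparr>\<^esub> (generate G {x})) \<and>
          card (rcosets\<^bsub>G\<lparr>carrier := centralizer G x\<rparr>\<^esub> (generate G {x})) \<le> n))"

text \<open>
  The subgroup \<open>{a \<in> A. a\<^sup>2 = 1}\<close> of an abelian group as a vector space over the field
  \<open>residue_ring 2\<close>, whose carrier is \<open>{0, 1} :: int set\<close>: vector addition is the group
  operation and scalar multiplication is exponentiation.  The fields \<open>mult\<close> and \<open>one\<close> are
  present only because module records extend ring records; they play no role in the vector
  space structure.
\<close>

definition two_torsion_space :: "('a, 'b) monoid_scheme \<Rightarrow> (int, 'a) module" where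
  "two_torsion_space A =
     \<lparr>carrier = {a \<in> carrier A. a [^]\<^bsub>A\<^esub> (2::nat) = \<one>\<^bsub>A\<^esub>},
      monoid.mult = (\<lambda>a b. a \<otimes>\<^bsub>A\<^esub> b), monoid.one = \<one>\<^bsub>A\<^esub>,
      ring.zero = \<one>\<^bsub>A\<^esub>, ring.add = (\<lambda>a b. a \<otimes>\<^bsub>A\<^esub> b),
      module.smult = (\<lambda>k a. a [^]\<^bsub>A\<^esub> k)\<rparr>"

lemma vectorspace_two_torsion_space:
  assumes "comm_group A"
  shows "vectorspace (residue_ring 2) (two_torsion_space A)"
proof -
  interpret A: comm_group A by fact
  interpret R: residues_prime 2 "residue_ring 2"
    by unfold_locales simp_all
  let ?V = "two_torsion_space A"
  have sq: "a \<otimes>\<^bsub>A\<^esub> a = \<one>\<^bsub>A\<^esub>" "a \<in> carrier A" if "a \<in> carrier ?V" for a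
    using that by (auto simp: two_torsion_space_def numeral_2_eq_2)
  have carrierI: "a \<in> carrier ?V" if "a \<in> carrier A" "a \<otimes>\<^bsub>A\<^esub> a = \<one>\<^bsub>A\<^esub>" for a
    using that by (auto simp: two_torsion_space_def numeral_2_eq_2)
  have V: "ring.zero ?V = \<one>\<^bsub>A\<^esub>" "ring.add ?V = monoid.mult A" "module.smult ?V = (\<lambda>k a. a [^]\<^bsub>A\<^esub> k)"
    by (simp_all add: two_torsion_space_def)
  have K: "carrier (residue_ring 2) = {0, 1}"
    by (auto simp: residue_ring_def)
  have K': "monoid.one (residue_ring 2) = 1" "monoid.mult (residue_ring 2) = (\<lambda>x y. (x * y) mod 2)"
    "ring.add (residue_ring 2) = (\<lambda>x y. (x + y) mod 2)"
    by (simp_all add: residue_ring_def)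
  have pow1: "a [^]\<^bsub>A\<^esub> (1::int) = a" if "a \<in> carrier A" for a
    using that by (simp add: A.int_pow_1)
  have carr: "a [^]\<^bsub>A\<^esub> k \<in> carrier ?V" if "a \<in> carrier ?V" "k \<in> {0, 1::int}" for a k
    using that sq[OF that(1)] pow1 by (auto intro: carrierI)
  have add_closed: "x \<otimes>\<^bsub>A\<^esub> y \<in> carrier ?V" if "x \<in> carrier ?V" "y \<in> carrier ?V" for x y
  proof (rule carrierI)
    note xy = sq(2)[OF that(1)] sq(2)[OF that(2)]
    show "x \<otimes>\<^bsub>A\<^esub> y \<in> carrier A" using xy by simp
    have "x \<otimes>\<^bsub>A\<^esub> y \<otimes>\<^bsub>A\<^esub> (x \<otimes>\<^bsub>A\<^esub> y) = (x \<otimes>\<^bsub>A\<^esub> x) \<otimes>\<^bsub>A\<^esub> (y \<otimes>\<^bsub>A\<^esub> y)"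
      using xy by (simp add: A.m_ac)
    then show "x \<otimes>\<^bsub>A\<^esub> y \<otimes>\<^bsub>A\<^esub> (x \<otimes>\<^bsub>A\<^esub> y) = \<one>\<^bsub>A\<^esub>"
      using sq(1)[OF that(1)] sq(1)[OF that(2)] by simp
  qed
  have ab: "abelian_group ?V"
  proof (rule abelian_groupI, unfold V)
    show "\<one>\<^bsub>A\<^esub> \<in> carrier ?V" by (rule carrierI) simp_all
    show "\<exists>y\<in>carrier ?V. y \<otimes>\<^bsub>A\<^esub> x = \<one>\<^bsub>A\<^esub>" if "x \<in> carrier ?V" for x
      using sq(1)[OF that] that by blast
    show "x \<otimes>\<^bsub>A\<^esub> y \<otimes>\<^bsub>A\<^esub> z = x \<otimes>\<^bsub>A\<^esub> (y \<otimes>\<^bsub>A\<^esub> z)"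
      if "x \<in> carrier ?V" "y \<in> carrier ?V" "z \<in> carrier ?V" for x y z
      using that[THEN sq(2)] by (rule A.m_assoc)
    show "x \<otimes>\<^bsub>A\<^esub> y = y \<otimes>\<^bsub>A\<^esub> x" if "x \<in> carrier ?V" "y \<in> carrier ?V" for x y
      using that[THEN sq(2)] by (rule A.m_comm)
    show "\<one>\<^bsub>A\<^esub> \<otimes>\<^bsub>A\<^esub> x = x" if "x \<in> carrier ?V" for x
      using sq(2)[OF that] by (rule A.l_one)
  qed (rule add_closed)
  have mod: "module (residue_ring 2) ?V"
  proof (rule moduleI, unfold V K K')
    show "cring (residue_ring 2)" by (rule R.cring)
    show "abelian_group ?V" by (rule ab)
    show "a [^]\<^bsub>A\<^esub> k \<in> carrier ?V" if "k \<in> {0, 1::int}" "a \<in> carrier ?V" for k a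
      using that(2,1) by (rule carr)
    show "x [^]\<^bsub>A\<^esub> ((a + b) mod 2) = x [^]\<^bsub>A\<^esub> a \<otimes>\<^bsub>A\<^esub> x [^]\<^bsub>A\<^esub> b"
      if "a \<in> {0, 1::int}" "b \<in> {0, 1}" "x \<in> carrier ?V" for a b x
      using that(1,2) sq[OF that(3)] by (elim insertE emptyE) (simp_all add: pow1)
    show "(x \<otimes>\<^bsub>A\<^esub> y) [^]\<^bsub>A\<^esub> a = x [^]\<^bsub>A\<^esub> a \<otimes>\<^bsub>A\<^esub> y [^]\<^bsub>A\<^esub> a"
      if "a \<in> {0, 1::int}" "x \<in> carrier ?V" "y \<in> carrier ?V" for a x y
      using sq(2)[OF that(2)] sq(2)[OF that(3)] by (rule A.int_pow_distrib)
    show "x [^]\<^bsub>A\<^esub> (a * b mod 2) = (x [^]\<^bsub>A\<^esub> b) [^]\<^bsub>A\<^esub> a"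
      if "a \<in> {0, 1::int}" "b \<in> {0, 1}" "x \<in> carrier ?V" for a b x
      using that(1,2) sq(2)[OF that(3)] by (elim insertE emptyE) (simp_all add: pow1)
    show "x [^]\<^bsub>A\<^esub> (1::int) = x" if "x \<in> carrier ?V" for x
      using sq(2)[OF that] by (rule pow1)
  qed
  show ?thesis
    unfolding vectorspace_def using mod R.is_field by blast
qed

definition two_rank :: "('a, 'b) monoid_scheme \<Rightarrow> enat" where
  "two_rank A =
     (if vectorspace.fin_dim (residue_ring 2) (two_torsion_space A)
      then enat (vectorspace.dim (residue_ring 2) (two_torsion_space A)) else \<infinity>)"

end

theory Submission
  imports Defs
begin

text \<open>
  If \<open>x\<close> has infinite order and \<open>\<langle>x\<^sup>k\<rangle>\<close> is not normal, then \<open>|C(x\<^sup>k) : \<langle>x\<^sup>k\<rangle>| \<ge> |\<langle>x\<rangle> : \<langle>x\<^sup>k\<rangle>| = k\<close>;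
  hence in a BCI-group \<open>\<langle>x\<^sup>k\<rangle>\<close> and \<open>\<langle>x\<^bsup>k+1\<^esup>\<rangle>\<close> are normal for large \<open>k\<close>, and so is \<open>\<langle>x\<rangle>\<close>.
  Thus every group element centralises or inverts every element of infinite order.  An element
  centralising (inverting) one \<open>x\<close> of infinite order then centralises (inverts) all of \<open>A = C(x)\<close>,
  so \<open>A\<close> is abelian of index at most 2.  If some \<open>g\<close> inverts \<open>A\<close>, then \<open>\<langle>g\<rangle>\<close> is finite and not normal,
  and \<open>C(g)\<close> contains the elements of \<open>A\<close> of order at most 2, which bounds the 2-rank.
  Conversely, in the groups of (iii) an element \<open>x\<close> with \<open>\<langle>x\<rangle>\<close> not normal lies outside \<open>A\<close>, and
  its centraliser meets \<open>A\<close> in the 2-torsion of \<open>A\<close>.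
\<close>

section \<open>Finite 2-rank and the 2-torsion subgroup\<close>

text \<open>A space of finite dimension over a finite field is finite, and a finite space is spanned
  by its own carrier. Linear algebra enters the proof only here; afterwards the 2-torsion is just a
  finite set.\<close>

lemma two_rank_finite_iff:
  fixes A :: "('a, 'b) monoid_scheme"
  assumes "comm_group A"
  shows "two_rank A < \<infinity> \<longleftrightarrow> finite {a \<in> carrier A. a [^]\<^bsub>A\<^esub> (2::nat) = \<one>\<^bsub>A\<^esub>}"
proof -
  interpret V: vectorspace "residue_ring 2" "two_torsion_space A"
    using assms by (rule vectorspace_two_torsion_space)
  have carr: "carrier (two_torsion_space A) = {a \<in> carrier A. a [^]\<^bsub>A\<^esub> (2::nat) = \<one>\<^bsub>A\<^esub>}"
    by (simp add: two_torsion_space_def)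
  have fK: "finite (carrier (residue_ring 2))"
    by (simp add: residue_ring_def)
  have "V.fin_dim \<longleftrightarrow> finite (carrier (two_torsion_space A))"
  proof
    assume "V.fin_dim"
    then obtain B where B: "finite B" "B \<subseteq> carrier (two_torsion_space A)"
      "V.span B = carrier (two_torsion_space A)"
      by (auto simp: V.fin_dim_def)
    \<comment> \<open>Only the values on \<open>B\<close> affect a linear combination. Restricting
      the coefficient functions to \<open>B\<close> leaves finitely many of them.\<close>
    have "V.span B \<subseteq> (\<lambda>c. V.lincomb c B) ` (B \<rightarrow>\<^sub>E carrier (residue_ring 2))"
    proof
      fix v assume "v \<in> V.span B"
      then obtain c where c: "c \<in> B \<rightarrow> carrier (residue_ring 2)" "v = V.lincomb c B"
        using V.finite_span[OF B(1,2)] by auto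
      then have "v = V.lincomb (restrict c B) B"
        using B(2) by (auto intro!: V.lincomb_cong)
      then show "v \<in> (\<lambda>c. V.lincomb c B) ` (B \<rightarrow>\<^sub>E carrier (residue_ring 2))"
        using c(1) by (auto intro!: image_eqI[of _ _ "restrict c B"])
    qed
    then show "finite (carrier (two_torsion_space A))"
      unfolding B(3) using B(1) fK by (meson finite_PiE finite_imageI finite_subset)
  next
    assume "finite (carrier (two_torsion_space A))"
    moreover have "V.span (carrier (two_torsion_space A)) = carrier (two_torsion_space A)"
      using V.in_own_span V.span_is_subset2 by blast
    ultimately show "V.fin_dim"
      unfolding V.fin_dim_def by blast
  qed
  then show ?thesis
    by (simp add: two_rank_def carr)
qed

section \<open>Conjugation and cyclic subgroups\<close>

context group
begin

lemma inv_cancel_left: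
  "\<lbrakk>z \<in> carrier G; y \<in> carrier G\<rbrakk> \<Longrightarrow> inv z \<otimes> (z \<otimes> y) = y"
  "\<lbrakk>z \<in> carrier G; y \<in> carrier G\<rbrakk> \<Longrightarrow> z \<otimes> (inv z \<otimes> y) = y"
  by (simp_all flip: m_assoc)

lemma conj_hom: "z \<in> carrier G \<Longrightarrow> (\<lambda>y. inv z \<otimes> y \<otimes> z) \<in> hom G G"
  by (rule homI) (simp_all add: m_assoc inv_cancel_left)

lemma conj_mult:
  "\<lbrakk>x \<in> carrier G; y \<in> carrier G; z \<in> carrier G\<rbrakk>
    \<Longrightarrow> inv z \<otimes> (x \<otimes> y) \<otimes> z = (inv z \<otimes> x \<otimes> z) \<otimes> (inv z \<otimes> y \<otimes> z)"
  using conj_hom by (simp add: hom_def)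

lemma conj_int_pow:
  "\<lbrakk>x \<in> carrier G; z \<in> carrier G\<rbrakk>
    \<Longrightarrow> inv z \<otimes> (x [^] (k::int)) \<otimes> z = (inv z \<otimes> x \<otimes> z) [^] k"
  using hom_int_pow[OF conj_hom _ group_axioms group_axioms] by blast

lemma conj_eq_iff:
  "\<lbrakk>x \<in> carrier G; y \<in> carrier G; z \<in> carrier G\<rbrakk>
    \<Longrightarrow> inv z \<otimes> x \<otimes> z = y \<longleftrightarrow> x \<otimes> z = z \<otimes> y"
  by (metis inv_closed inv_solve_left m_assoc m_closed)

lemma int_pow_eq_one_iff:
  "\<lbrakk>x \<in> carrier G; ord x = 0\<rbrakk> \<Longrightarrow> x [^] (k::int) = \<one> \<longleftrightarrow> k = 0"
  by (simp add: int_pow_eq_id)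

lemma int_pow_eq_int_pow_iff:
  "\<lbrakk>x \<in> carrier G; ord x = 0\<rbrakk> \<Longrightarrow> x [^] (k::int) = x [^] m \<longleftrightarrow> k = m"
  by (auto simp: int_pow_eq)

lemma inv_neq_self:
  assumes "x \<in> carrier G" "ord x = 0"
  shows "inv x \<noteq> x"
  using int_pow_eq_int_pow_iff[OF assms, of "-1" 1] assms by (simp add: int_pow_neg)

text \<open>Conjugation is a homomorphism, so it suffices to test the generator.\<close>

lemma generate_singleton_normalI:
  assumes x: "x \<in> carrier G"
    and conj: "\<And>z. z \<in> carrier G \<Longrightarrow> inv z \<otimes> x \<otimes> z \<in> generate G {x}"
  shows "generate G {x} \<lhd> G"
proof (rule normal_invI)
  show sub: "subgroup (generate G {x}) G"
    using x by (intro generate_is_subgroup) simp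
  fix z h assume z: "z \<in> carrier G" and "h \<in> generate G {x}"
  then obtain k :: int where h: "h = x [^] k"
    using generate_pow[OF x] by auto
  \<comment> \<open>\<open>normal_invI\<close> conjugates in the opposite direction, so the
    hypothesis is applied to \<open>inv z\<close>.\<close>
  have "inv (inv z) \<otimes> h \<otimes> inv z = (inv (inv z) \<otimes> x \<otimes> inv z) [^] k"
    unfolding h using x z by (intro conj_int_pow) simp_all
  moreover have "\<dots> \<in> generate G {x}"
    using z by (intro subgroup_int_pow_closed[OF sub] conj) simp
  ultimately show "z \<otimes> h \<otimes> inv z \<in> generate G {x}"
    using z by simp
qed

lemma normal_generate_conj:
  assumes "generate G {x} \<lhd> G" "x \<in> carrier G" "z \<in> carrier G"
  obtains k :: int where "inv z \<otimes> x \<otimes> z = x [^] k"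
proof -
  have "inv z \<otimes> x \<otimes> z \<in> generate G {x}"
    using normal.inv_op_closed1[OF assms(1,3)] by (simp add: generate.incl)
  then show ?thesis
    using generate_pow[OF assms(2)] that by auto
qed

text \<open>Conjugations by \<open>z\<close> and by \<open>inv z\<close> act on the infinite cyclic
  group as powers \<open>k\<close> and \<open>m\<close> and undo each other. Hence
  \<open>k * m = 1\<close> in the integers, and \<open>k\<close> is 1 or -1.\<close>

lemma normal_generate_conj_cases:
  assumes N: "generate G {x} \<lhd> G" and x: "x \<in> carrier G" "ord x = 0" and z: "z \<in> carrier G"
  shows "inv z \<otimes> x \<otimes> z = x \<or> inv z \<otimes> x \<otimes> z = inv x"
proof -
  obtain k :: int where k: "inv z \<otimes> x \<otimes> z = x [^] k"
    using normal_generate_conj[OF N x(1) z] .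
  obtain m :: int where m: "inv (inv z) \<otimes> x \<otimes> inv z = x [^] m"
    using normal_generate_conj[OF N x(1) inv_closed[OF z]] .
  have "x = inv z \<otimes> (inv (inv z) \<otimes> x \<otimes> inv z) \<otimes> z"
    using x z by (simp add: m_assoc inv_cancel_left)
  also have "\<dots> = (x [^] k) [^] m"
    unfolding m k[symmetric] using x z by (intro conj_int_pow)
  finally have "x [^] (k * m) = x [^] (1::int)"
    using x by (simp add: int_pow_pow)
  then have "k * m = 1"
    using int_pow_eq_int_pow_iff[OF x] by blast
  then have "k = 1 \<or> k = -1"
    by (auto simp: zmult_eq_1_iff)
  then show ?thesis
    using k x by (auto simp: int_pow_neg)
qed

section \<open>Centralisers and infinite cyclic subgroups of BCI-groups\<close>

lemma subgroup_centralizer: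
  assumes "x \<in> carrier G"
  shows "subgroup (centralizer G x) G"
proof
  fix y assume "y \<in> centralizer G x"
  then have y: "y \<in> carrier G" "y \<otimes> x = x \<otimes> y"
    by (simp_all add: centralizer_def)
  then have "x = inv y \<otimes> (x \<otimes> y)"
    using assms inv_cancel_left(1)[of y x] by simp
  then have "inv y \<otimes> x \<otimes> y = x"
    using assms y by (simp add: m_assoc)
  then have "inv y \<otimes> x = x \<otimes> inv y"
    using assms y inv_solve_right[of x "inv y \<otimes> x" y] by (metis inv_closed m_closed inv_solve_right)
  then show "inv y \<in> centralizer G x"
    using y by (simp add: centralizer_def)
next
  fix y z assume "y \<in> centralizer G x" "z \<in> centralizer G x"
  then show "y \<otimes> z \<in> centralizer G x"
    using assms by (auto simp: centralizer_def) (metis m_assoc)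
qed (use assms in \<open>auto simp: centralizer_def\<close>)

text \<open>The powers of \<open>x\<close> with exponents below \<open>k\<close> centralise
  \<open>x [^] int k\<close> and lie in distinct cosets of the subgroup it generates. Finiteness is
  assumed because \<open>card\<close> is 0 on infinite sets.\<close>

lemma index_centralizer_int_pow:
  assumes x: "x \<in> carrier G" "ord x = 0"
    and fin: "finite (rcosets\<^bsub>G\<lparr>carrier := centralizer G (x [^] int k)\<rparr>\<^esub> (generate G {x [^] int k}))"
  shows "k \<le> card (rcosets\<^bsub>G\<lparr>carrier := centralizer G (x [^] int k)\<rparr>\<^esub> (generate G {x [^] int k}))"
proof -
  let ?H = "generate G {x [^] int k}" and ?C = "G\<lparr>carrier := centralizer G (x [^] int k)\<rparr>"
  let ?f = "\<lambda>i::nat. ?H #>\<^bsub>?C\<^esub> (x [^] int i)"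
  have H: "?H = {x [^] (int k * m) | m. True}"
    using x by (auto simp: generate_pow int_pow_pow)
  have "inj_on ?f {..<k}"
  proof (rule inj_onI)
    fix i j assume i: "i \<in> {..<k}" and j: "j \<in> {..<k}" and eq: "?f i = ?f j"
    have "\<one> \<in> ?H" by (rule generate.one)
    then have "x [^] int i \<in> ?f i"
      using x by (force simp: r_coset_def)
    then have "x [^] int i \<in> ?f j"
      by (simp only: eq)
    then obtain m where "x [^] int i = x [^] (int k * m) \<otimes> x [^] int j"
      unfolding H by (auto simp: r_coset_def)
    then have "int i = int k * m + int j"
      using x by (simp only: int_pow_mult[symmetric] int_pow_eq_int_pow_iff)
    then have "int i mod int k = int j mod int k"
      by simp
    then show "i = j"
      using i j by simp
  qed
  then have "k = card (?f ` {..<k})"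
    by (simp add: card_image)
  also have "\<dots> \<le> card (rcosets\<^bsub>?C\<^esub> ?H)"
  proof (rule card_mono[OF fin], rule image_subsetI)
    fix i
    have "x [^] int i \<in> centralizer G (x [^] int k)"
      using x by (simp add: centralizer_def flip: int_pow_mult) (simp add: add.commute)
    then show "?f i \<in> rcosets\<^bsub>?C\<^esub> ?H"
      by (auto simp: RCOSETS_def)
  qed
  finally show ?thesis .
qed

text \<open>The index bound \<open>n\<close> directly gives normality only for the subgroups
  generated by \<open>x [^] int k\<close> with \<open>k > n\<close>. Two consecutive such exponents
  bring it down to \<open>x\<close> itself.\<close>

lemma bci_group_infinite_cyclic_normal:
  assumes bci: "bci_group G" and x: "x \<in> carrier G" "ord x = 0"
  shows "generate G {x} \<lhd> G"
proof -
  obtain n :: nat where n: "\<And>x. x \<in> carrier G \<Longrightarrow> \<not> (generate G {x} \<lhd> G) \<Longrightarrow>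
      finite (rcosets\<^bsub>G\<lparr>carrier := centralizer G x\<rparr>\<^esub> (generate G {x})) \<and>
      card (rcosets\<^bsub>G\<lparr>carrier := centralizer G x\<rparr>\<^esub> (generate G {x})) \<le> n"
    using bci unfolding bci_group_def by blast
  have normal: "generate G {x [^] int k} \<lhd> G" if "k > n" for k
    using index_centralizer_int_pow[OF x, of k] n[of "x [^] int k"] x that by fastforce
  have sub: "subgroup (generate G {x}) G"
    using x by (intro generate_is_subgroup) simp
  have conj_pow: "inv z \<otimes> (x [^] int k) \<otimes> z \<in> generate G {x}" if "k > n" "z \<in> carrier G" for k z
    using normal_generate_conj[OF normal[OF that(1)] int_pow_closed[OF x(1)] that(2)]
      generate_pow[OF x(1)] x by (auto simp: int_pow_pow)
  show ?thesis
  proof (rule generate_singleton_normalI[OF x(1)])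
    fix z assume z: "z \<in> carrier G"
    let ?c = "inv z \<otimes> x \<otimes> z"
    have c: "?c \<in> carrier G" using x z by simp
    have "?c [^] int k \<in> generate G {x}" if "k > n" for k
      using conj_pow[OF that z] conj_int_pow[OF x(1) z] by simp
    \<comment> \<open>These are the first two exponents above \<open>n\<close>; the quotient of the
      corresponding powers of \<open>?c\<close> is \<open>?c\<close>.\<close>
    from this[of "Suc (Suc n)"] this[of "Suc n"]
    have "?c [^] int (Suc (Suc n)) \<otimes> inv (?c [^] int (Suc n)) \<in> generate G {x}"
      using sub by (meson lessI less_SucI subgroup.m_closed subgroup.m_inv_closed)
    moreover have "?c [^] int (Suc (Suc n)) \<otimes> inv (?c [^] int (Suc n)) = ?c"
      using int_pow_diff[OF c, of "int (Suc (Suc n))" "int (Suc n)"] c by simp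
    ultimately show "?c \<in> generate G {x}" by simp
  qed
qed

text \<open>If \<open>x \<otimes> y\<close> had finite order, the product of its order and that of
  \<open>y\<close> would annihilate both elements, hence also \<open>x\<close>.\<close>

lemma ord_mult_torsion:
  assumes "x \<in> carrier G" "y \<in> carrier G" "x \<otimes> y = y \<otimes> x" "ord x = 0" "ord y \<noteq> 0"
  shows "ord (x \<otimes> y) = 0"
proof (rule ccontr)
  let ?m = "ord (x \<otimes> y) * ord y"
  assume "ord (x \<otimes> y) \<noteq> 0"
  then have "?m \<noteq> 0" using assms by simp
  have "(x \<otimes> y) [^] ?m = \<one>" "y [^] ?m = \<one>"
    using assms by (simp_all add: pow_eq_id)
  then have "x [^] ?m = \<one>"
    using pow_mult_distrib[of x y ?m] assms by simp
  with \<open>?m \<noteq> 0\<close> show False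
    using assms by (simp add: pow_eq_id)
qed

end

section \<open>Groups in which elements of infinite order are centralised or inverted\<close>

text \<open>This isolates what the BCI condition contributes to the structure of centralisers. The
  alternative may a priori vary with both \<open>x\<close> and \<open>z\<close>; the lemmas below
  show that it is constant on commuting elements of infinite order.\<close>

locale infinite_order_inverting = group +
  assumes conj_cases: "\<lbrakk>x \<in> carrier G; z \<in> carrier G; ord x = 0\<rbrakk>
    \<Longrightarrow> inv z \<otimes> x \<otimes> z = x \<or> inv z \<otimes> x \<otimes> z = inv x"
begin

lemma conj_fixed_infinite_order:
  assumes x: "x \<in> carrier G" "ord x = 0" and y: "y \<in> carrier G" "ord y = 0"
    and xy: "x \<otimes> y = y \<otimes> x"
    and z: "z \<in> carrier G" "inv z \<otimes> x \<otimes> z = x"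
  shows "inv z \<otimes> y \<otimes> z = y"
proof (rule ccontr)
  assume "inv z \<otimes> y \<otimes> z \<noteq> y"
  then have inv_y: "inv z \<otimes> y \<otimes> z = inv y"
    using conj_cases[OF y(1) z(1) y(2)] by blast
  have xy_conj: "inv z \<otimes> (x \<otimes> y) \<otimes> z = x \<otimes> inv y"
    using x y z inv_y by (simp add: conj_mult)
  show False
  \<comment> \<open>If the product has infinite order, it is fixed or inverted too, which forces
    \<open>inv y = y\<close> or \<open>inv x = x\<close>.\<close>
  proof (cases "ord (x \<otimes> y) = 0")
    case True
    then have "x \<otimes> inv y = x \<otimes> y \<or> x \<otimes> inv y = inv (x \<otimes> y)"
      using conj_cases[of "x \<otimes> y" z] x y z xy_conj by simp
    then have "x \<otimes> inv y = x \<otimes> y \<or> x \<otimes> inv y = inv x \<otimes> inv y"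
      using xy x y by (simp add: inv_mult_group)
    then show False
      using x y inv_neq_self[OF x] inv_neq_self[OF y] by auto
  next
    case False
    let ?m = "ord (x \<otimes> y)"
    have "x [^] int ?m \<otimes> y [^] int ?m = \<one>"
      using int_pow_mult_distrib[OF xy x(1) y(1), of "int ?m"] x y by (simp add: int_pow_int)
    \<comment> \<open>As a power of \<open>x\<close> this element is fixed by \<open>z\<close>,
      whereas its inverse, a power of \<open>y\<close>, is inverted by \<open>z\<close>. So
      \<open>y [^] int ?m\<close> equals its own inverse, although \<open>y\<close> has infinite
      order.\<close>
    then have ym: "inv (y [^] int ?m) = x [^] int ?m"
      using x y by (metis int_pow_closed inv_equality)
    have "inv z \<otimes> y [^] int ?m \<otimes> z = inv (y [^] int ?m)"
      using conj_int_pow[OF y(1) z(1)] inv_y y by (simp add: int_pow_inv)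
    moreover have "inv z \<otimes> inv (y [^] int ?m) \<otimes> z = inv (y [^] int ?m)"
      using conj_int_pow[OF x(1) z(1), of "int ?m"] z unfolding ym by simp
    ultimately have "inv z \<otimes> y [^] int ?m \<otimes> z = inv z \<otimes> inv (y [^] int ?m) \<otimes> z"
      by simp
    then have "y [^] int ?m = inv (y [^] int ?m)"
      using y z by simp
    then have "y [^] int ?m = y [^] (- int ?m)"
      using y by (simp add: int_pow_neg)
    then show False
      using int_pow_eq_int_pow_iff[OF y] False by fastforce
  qed
qed

text \<open>A torsion element \<open>y\<close> is reached through \<open>x \<otimes> y\<close>,
  which has infinite order and commutes with \<open>x\<close>: if \<open>z\<close> fixes
  \<open>x\<close> and \<open>x \<otimes> y\<close>, it fixes \<open>y\<close>.\<close>

lemma conj_fixed_commuting: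
  assumes x: "x \<in> carrier G" "ord x = 0" and y: "y \<in> carrier G"
    and xy: "x \<otimes> y = y \<otimes> x"
    and z: "z \<in> carrier G" "inv z \<otimes> x \<otimes> z = x"
  shows "inv z \<otimes> y \<otimes> z = y"
proof (cases "ord y = 0")
  case True
  then show ?thesis using assms conj_fixed_infinite_order by blast
next
  case False
  have "x \<otimes> (x \<otimes> y) = x \<otimes> y \<otimes> x"
    using x y xy by (metis m_assoc)
  then have "inv z \<otimes> (x \<otimes> y) \<otimes> z = x \<otimes> y"
    using conj_fixed_infinite_order[of x "x \<otimes> y" z] ord_mult_torsion[OF x(1) y xy x(2) False] x y z
    by simp
  then have "x \<otimes> (inv z \<otimes> y \<otimes> z) = x \<otimes> y"
    using x y z by (simp only: conj_mult)
  then show ?thesis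
    using x y z by simp
qed

lemma conj_inverted_commuting:
  assumes x: "x \<in> carrier G" "ord x = 0" and y: "y \<in> carrier G"
    and xy: "x \<otimes> y = y \<otimes> x"
    and z: "z \<in> carrier G" "inv z \<otimes> x \<otimes> z = inv x"
  shows "inv z \<otimes> y \<otimes> z = inv y"
proof -
  have inverted: "inv z \<otimes> w \<otimes> z = inv w"
    if w: "w \<in> carrier G" "ord w = 0" "x \<otimes> w = w \<otimes> x" for w
  proof (rule ccontr)
    assume "inv z \<otimes> w \<otimes> z \<noteq> inv w"
    then have "inv z \<otimes> w \<otimes> z = w"
      using conj_cases w z by blast
    \<comment> \<open>The roles are exchanged here: fixing \<open>w\<close> forces \<open>z\<close>
      to fix \<open>x\<close>, which it inverts.\<close>
    then have "inv z \<otimes> x \<otimes> z = x"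
      using conj_fixed_commuting[of w x z] w x z by simp
    then show False
      using z(2) inv_neq_self[OF x] by simp
  qed
  show ?thesis
  proof (cases "ord y = 0")
    case True
    then show ?thesis using inverted y xy by blast
  next
    case False
    have "x \<otimes> (x \<otimes> y) = x \<otimes> y \<otimes> x"
      using x y xy by (metis m_assoc)
    then have "inv z \<otimes> (x \<otimes> y) \<otimes> z = inv (x \<otimes> y)"
      using inverted[of "x \<otimes> y"] ord_mult_torsion[OF x(1) y xy x(2) False] x y by simp
    also have "\<dots> = inv x \<otimes> inv y"
      using x y xy by (simp add: inv_mult_group)
    finally have "inv x \<otimes> (inv z \<otimes> y \<otimes> z) = inv x \<otimes> inv y"
      using x y z by (simp only: conj_mult)
    then show ?thesis
      using x y z by simp
  qed
qed

text \<open>Any \<open>z\<close> in the centraliser fixes \<open>x\<close> under conjugation, hence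
  by \<open>conj_fixed_commuting\<close> it fixes everything that commutes with
  \<open>x\<close>.\<close>

lemma comm_group_centralizer:
  assumes x: "x \<in> carrier G" "ord x = 0"
  shows "comm_group (G\<lparr>carrier := centralizer G x\<rparr>)"
proof -
  interpret C: group "G\<lparr>carrier := centralizer G x\<rparr>"
    using subgroup_centralizer[OF x(1)] by (rule subgroup_imp_group)
  show ?thesis
  proof (rule C.group_comm_groupI)
    fix y z assume "y \<in> carrier (G\<lparr>carrier := centralizer G x\<rparr>)"
      "z \<in> carrier (G\<lparr>carrier := centralizer G x\<rparr>)"
    then have yz: "y \<in> carrier G" "z \<in> carrier G" "y \<otimes> x = x \<otimes> y" "z \<otimes> x = x \<otimes> z"
      by (auto simp: centralizer_def)
    then have "inv z \<otimes> y \<otimes> z = y"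
      using conj_fixed_commuting[OF x, of y z] conj_eq_iff[of x x z] x by simp
    then show "y \<otimes>\<^bsub>G\<lparr>carrier := centralizer G x\<rparr>\<^esub> z = z \<otimes>\<^bsub>G\<lparr>carrier := centralizer G x\<rparr>\<^esub> y"
      using conj_eq_iff[of y y z] yz by simp
  qed
qed

end

section \<open>Non-abelian BCI-groups are of the form in (iii)\<close>

context group
begin

lemma bci_group_imp_generalized_dihedral:
  assumes bci: "bci_group G" and "non_periodic G" and "\<not> comm_group G"
  shows "\<exists>A g. subgroup A G \<and> comm_group (G\<lparr>carrier := A\<rparr>) \<and>
                non_periodic (G\<lparr>carrier := A\<rparr>) \<and> two_rank (G\<lparr>carrier := A\<rparr>) < \<infinity> \<and>
                g \<in> carrier G \<and> ord g \<noteq> 0 \<and> ord g \<le> 4 \<and>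
                g [^] (2::nat) \<in> A \<and>
                (\<forall>a\<in>A. inv g \<otimes> a \<otimes> g = inv a) \<and>
                carrier G = generate G (insert g A)"
proof -
  interpret infinite_order_inverting G
    by unfold_locales
      (use normal_generate_conj_cases bci_group_infinite_cyclic_normal[OF bci] in blast)
  obtain x where x: "x \<in> carrier G" "ord x = 0"
    using \<open>non_periodic G\<close> unfolding non_periodic_def by blast
  define A where "A = centralizer G x"
  have sub: "subgroup A G"
    unfolding A_def using x(1) by (rule subgroup_centralizer)
  have comm: "comm_group (G\<lparr>carrier := A\<rparr>)"
    unfolding A_def using x by (rule comm_group_centralizer)
  have A_iff: "a \<in> A \<longleftrightarrow> a \<in> carrier G \<and> inv a \<otimes> x \<otimes> a = x" for a
    using x by (auto simp: A_def centralizer_def conj_eq_iff)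
  have "A \<noteq> carrier G"
    using comm \<open>\<not> comm_group G\<close> by auto
  then obtain g where g: "g \<in> carrier G" "g \<notin> A"
    using subgroup.subset[OF sub] by blast
  have inverts_x: "inv h \<otimes> x \<otimes> h = inv x" if "h \<in> carrier G" "h \<notin> A" for h
    using conj_cases[OF x(1) that(1) x(2)] that A_iff by blast
  have inverts: "inv g \<otimes> a \<otimes> g = inv a" if "a \<in> A" for a
    using conj_inverted_commuting[OF x _ _ g(1) inverts_x[OF g], of a] that
    by (auto simp: A_def centralizer_def)
  \<comment> \<open>Two inversions of \<open>x\<close> cancel, so products of elements outside
    \<open>A\<close> fall into \<open>A\<close>: the index of \<open>A\<close> is 2.\<close>
  have mult_A: "h \<otimes> k \<in> A" if "h \<in> carrier G" "h \<notin> A" "k \<in> carrier G" "k \<notin> A" for h k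
  proof -
    have "inv (h \<otimes> k) \<otimes> x \<otimes> (h \<otimes> k) = inv k \<otimes> (inv h \<otimes> x \<otimes> h) \<otimes> k"
      using that x by (simp add: inv_mult_group m_assoc)
    also have "\<dots> = inv k \<otimes> inv x \<otimes> k"
      using inverts_x[OF that(1,2)] by simp
    also have "\<dots> = inv (inv k \<otimes> x \<otimes> k)"
      using that x by (simp add: inv_mult_group m_assoc)
    also have "\<dots> = x"
      using that x by (simp add: inverts_x)
    finally show ?thesis
      using that by (simp add: A_iff)
  qed
  have sq: "g [^] (2::nat) \<in> A"
    using mult_A[OF g g] g by (simp add: numeral_2_eq_2)
  \<comment> \<open>The element \<open>g\<close> centralises its own square but inverts it as a
    member of \<open>A\<close>; therefore the fourth power of \<open>g\<close> is trivial.\<close>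
  have "inv g \<otimes> g [^] (2::nat) \<otimes> g = g [^] (2::nat)"
    using g by (simp add: numeral_2_eq_2 inv_cancel_left m_assoc)
  with inverts[OF sq] have "inv (g [^] (2::nat)) = g [^] (2::nat)"
    by simp
  then have "g [^] (2::nat) \<otimes> g [^] (2::nat) = \<one>"
    using g by (metis nat_pow_closed r_inv)
  then have "g [^] (4::nat) = \<one>"
    using g by (simp add: nat_pow_mult)
  then have "ord g dvd 4"
    using g by (simp add: pow_eq_id)
  then have ord: "ord g \<noteq> 0" "ord g \<le> 4"
    by (auto intro: Nat.gr0I dvd_imp_le)
  have gen: "carrier G = generate G (insert g A)"
  proof
    show "generate G (insert g A) \<subseteq> carrier G"
      using g subgroup.subset[OF sub] by (intro generate_incl) simp
    show "carrier G \<subseteq> generate G (insert g A)"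
    proof
      fix h assume h: "h \<in> carrier G"
      show "h \<in> generate G (insert g A)"
      proof (cases "h \<in> A")
        case False
        have "g \<otimes> h \<in> A"
          using mult_A g h False by blast
        then have "inv g \<otimes> (g \<otimes> h) \<in> generate G (insert g A)"
          by (intro generate.eng generate.inv generate.incl) simp_all
        then show ?thesis
          using g h by (simp add: m_assoc[symmetric])
      qed (simp add: generate.incl)
    qed
  qed
  \<comment> \<open>Since \<open>g\<close> inverts \<open>x\<close>, normality would put
    \<open>x [^] (-2::int)\<close> into the finite group generated by \<open>g\<close>, against the
    infinite order of \<open>x\<close>.\<close>
  have "\<not> generate G {g} \<lhd> G"
  proof
    assume N: "generate G {g} \<lhd> G"
    have gx: "x \<otimes> g = g \<otimes> inv x"
      using inverts_x[OF g] conj_eq_iff[of x "inv x" g] x g by simp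
    obtain k :: int where k: "inv x \<otimes> g \<otimes> x = g [^] k"
      using normal_generate_conj[OF N g(1) x(1)] .
    have "g \<otimes> x = inv x \<otimes> g"
      using x g gx by (metis inv_closed inv_inv inv_solve_left inv_solve_right m_assoc m_closed)
    then have "g [^] k = inv x \<otimes> inv x \<otimes> g"
      using x g k by (simp add: m_assoc)
    then have "inv x \<otimes> inv x = g [^] (k - 1)"
      using x g by (simp add: int_pow_diff inv_solve_right)
    then have "x [^] (-2::int) = g [^] (k - 1)"
      using x int_pow_mult[of x "-1" "-1"] by (simp add: int_pow_neg)
    then have "(x [^] (-2::int)) [^] int (ord g) = (g [^] (k - 1)) [^] int (ord g)"
      by simp
    also have "\<dots> = \<one>"
      using g by (simp add: int_pow_pow int_pow_eq_id)
    finally show False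
      using x ord by (simp add: int_pow_pow int_pow_eq_one_iff)
  qed
  then have fin: "finite (rcosets\<^bsub>G\<lparr>carrier := centralizer G g\<rparr>\<^esub> (generate G {g}))"
    using bci g unfolding bci_group_def by blast
  \<comment> \<open>The centraliser is a union of finitely many cosets of a finite subgroup.\<close>
  have finite_C: "finite (centralizer G g)"
  proof -
    interpret C: group "G\<lparr>carrier := centralizer G g\<rparr>"
      using subgroup_centralizer[OF g(1)] by (rule subgroup_imp_group)
    have "generate G {g} \<subseteq> centralizer G g"
      using g by (intro generate_subgroup_incl subgroup_centralizer) (simp_all add: centralizer_def)
    then have sub_C: "subgroup (generate G {g}) (G\<lparr>carrier := centralizer G g\<rparr>)"
      using g by (intro subgroup_incl generate_is_subgroup subgroup_centralizer) simp_all
    have "finite (generate G {g})"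
      using finite_cyclic_subgroup_order[OF g(1)] ord g by (simp add: carrier_subgroup_generated)
    then have "finite (\<Union>(rcosets\<^bsub>G\<lparr>carrier := centralizer G g\<rparr>\<^esub> (generate G {g})))"
      using fin C.rcosets_finite subgroup.subset[OF sub_C] by blast
    then show ?thesis
      using C.rcosets_part_G[OF sub_C] by simp
  qed
  \<comment> \<open>An element of order at most 2 is its own inverse, so being inverted by
    \<open>g\<close> means commuting with \<open>g\<close>.\<close>
  have "{a \<in> A. a [^] (2::nat) = \<one>} \<subseteq> centralizer G g"
  proof
    fix a assume "a \<in> {a \<in> A. a [^] (2::nat) = \<one>}"
    then have a: "a \<in> A" "a \<in> carrier G" "a \<otimes> a = \<one>"
      using subgroup.subset[OF sub] by (auto simp: numeral_2_eq_2)
    then have "inv g \<otimes> a \<otimes> g = a"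
      using inverts[of a] by (simp add: inv_equality)
    then show "a \<in> centralizer G g"
      using a g conj_eq_iff[of a a g] by (simp add: centralizer_def)
  qed
  then have "finite {a \<in> A. a [^] (2::nat) = \<one>}"
    using finite_C by (rule finite_subset)
  moreover have "a [^]\<^bsub>G\<lparr>carrier := A\<rparr>\<^esub> (2::nat) = a [^] (2::nat)" for a
    by (simp add: nat_pow_def)
  ultimately have rank: "two_rank (G\<lparr>carrier := A\<rparr>) < \<infinity>"
    unfolding two_rank_finite_iff[OF comm] by simp
  have "x \<in> A"
    using x by (simp add: A_def centralizer_def)
  moreover have "group.ord (G\<lparr>carrier := A\<rparr>) x = 0"
    using group.ord_eq_0[OF subgroup_imp_group[OF sub], of x] ord_eq_0[OF x(1)] x \<open>x \<in> A\<close>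
    by (simp add: nat_pow_def)
  ultimately have "non_periodic (G\<lparr>carrier := A\<rparr>)"
    unfolding non_periodic_def by auto
  with sub comm rank g ord sq inverts gen show ?thesis
    by blast
qed

section \<open>From (iii) to bounded centralisers, and back to BCI-groups\<close>

text \<open>The group is the union of \<open>A\<close> and the coset of \<open>g\<close>. For
  \<open>x\<close> outside \<open>A\<close> the centraliser lies in the union of the 2-torsion
  \<open>T\<close> and its translate by \<open>x\<close>, so twice the size of \<open>T\<close> is a
  uniform bound.\<close>

lemma generalized_dihedral_centralizer_bound:
  assumes sub: "subgroup A G" and comm: "comm_group (G\<lparr>carrier := A\<rparr>)"
    and rank: "two_rank (G\<lparr>carrier := A\<rparr>) < \<infinity>"
    and g: "g \<in> carrier G" "g [^] (2::nat) \<in> A"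
    and inverts: "\<And>a. a \<in> A \<Longrightarrow> inv g \<otimes> a \<otimes> g = inv a"
    and gen: "carrier G = generate G (insert g A)"
  shows "\<exists>n::nat. \<forall>x\<in>carrier G. \<not> (generate G {x} \<lhd> G) \<longrightarrow>
               finite (centralizer G x) \<and> card (centralizer G x) \<le> n"
proof -
  define T where "T = {a \<in> A. a [^] (2::nat) = \<one>}"
  have "a [^]\<^bsub>G\<lparr>carrier := A\<rparr>\<^esub> (2::nat) = a [^] (2::nat)" for a
    by (simp add: nat_pow_def)
  then have "finite T"
    using rank unfolding two_rank_finite_iff[OF comm] T_def by simp
  interpret A: subgroup A G by (fact sub)
  interpret A': comm_group "G\<lparr>carrier := A\<rparr>" by (fact comm)
  have A_comm: "a \<otimes> b = b \<otimes> a" if "a \<in> A" "b \<in> A" for a b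
    using A'.m_comm[of a b] that by simp
  have swap: "a \<otimes> g = g \<otimes> inv a" if "a \<in> A" for a
    using inverts[OF that] conj_eq_iff[of a "inv a" g] that g by simp
  \<comment> \<open>The union of \<open>A\<close> and its coset by \<open>g\<close> is closed under
    products, since \<open>swap\<close> moves \<open>g\<close> to the left past \<open>A\<close> and
    two copies of \<open>g\<close> merge into an element of \<open>A\<close>.\<close>
  have decomp: "h \<in> A \<or> (\<exists>a\<in>A. h = g \<otimes> a)" if "h \<in> carrier G" for h
    using that unfolding gen
  proof (induction h rule: generate.induct)
    case one
    show ?case by simp
  next
    case (incl h)
    then show ?case using g by (auto intro!: bexI[of _ \<one>])
  next
    case (inv h)
    have "inv g = g \<otimes> inv (g [^] (2::nat))"
      using g by (simp add: numeral_2_eq_2 inv_mult_group m_assoc[symmetric])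
    with inv show ?case
      using A.m_inv_closed[OF g(2)] by auto
  next
    case (eng h k)
    consider "h \<in> A" "k \<in> A" | a where "a \<in> A" "h = g \<otimes> a" "k \<in> A"
      | b where "b \<in> A" "h \<in> A" "k = g \<otimes> b"
      | a b where "a \<in> A" "b \<in> A" "h = g \<otimes> a" "k = g \<otimes> b"
      using eng.IH by blast
    then show ?case
    proof cases
      case 1
      then show ?thesis by simp
    next
      case (2 a)
      then have "h \<otimes> k = g \<otimes> (a \<otimes> k)"
        using g by (simp add: m_assoc)
      then show ?thesis using 2 by blast
    next
      case (3 b)
      then have "h \<otimes> k = (h \<otimes> g) \<otimes> b"
        using g by (simp add: m_assoc)
      also have "\<dots> = g \<otimes> (inv h \<otimes> b)"
        using 3 g by (simp add: swap m_assoc)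
      finally show ?thesis using 3 by blast
    next
      case (4 a b)
      then have "h \<otimes> k = g \<otimes> (a \<otimes> g) \<otimes> b"
        using g by (simp add: m_assoc)
      also have "\<dots> = g [^] (2::nat) \<otimes> (inv a \<otimes> b)"
        using 4 g by (simp add: swap m_assoc numeral_2_eq_2)
      finally show ?thesis using 4 g by simp
    qed
  qed
  have bound: "finite (centralizer G x) \<and> card (centralizer G x) \<le> card T + card T"
    if x: "x \<in> carrier G" and nn: "\<not> (generate G {x} \<lhd> G)" for x
  proof -
    \<comment> \<open>Elements of \<open>A\<close> are centralised by \<open>A\<close> and inverted
      by the other coset, so they generate normal subgroups.\<close>
    have "x \<notin> A"
    proof
      assume xA: "x \<in> A"
      have "generate G {x} \<lhd> G"
      proof (rule generate_singleton_normalI[OF x])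
        fix z assume z: "z \<in> carrier G"
        have "inv z \<otimes> x \<otimes> z = x \<or> inv z \<otimes> x \<otimes> z = inv x"
        proof (cases "z \<in> A")
          case True
          then show ?thesis
            using conj_eq_iff[of x x z] A_comm[OF xA True] x z by simp
        next
          case False
          then obtain a where a: "a \<in> A" "z = g \<otimes> a"
            using decomp[OF z] by blast
          have "x \<otimes> z = (x \<otimes> g) \<otimes> a"
            using a g x by (simp add: m_assoc)
          also have "\<dots> = g \<otimes> (inv x \<otimes> a)"
            using a g x xA by (simp add: swap m_assoc)
          also have "\<dots> = z \<otimes> inv x"
            using a g x xA by (simp add: A_comm m_assoc)
          finally show ?thesis
            using conj_eq_iff[of x "inv x" z] x z by simp
        qed
        then show "inv z \<otimes> x \<otimes> z \<in> generate G {x}"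
          by (auto intro: generate.incl generate.inv)
      qed
      with nn show False by simp
    qed
    then obtain a where a: "a \<in> A" "x = g \<otimes> a"
      using decomp[OF x] by blast
    \<comment> \<open>As \<open>a\<close> commutes with \<open>A\<close>, conjugation by
      \<open>x\<close> inverts \<open>A\<close> just as \<open>g\<close> does; a \<open>b\<close>
      commuting with \<open>x\<close> thus equals its inverse.\<close>
    have C_A: "b \<in> T" if b: "b \<in> A" "b \<otimes> x = x \<otimes> b" for b
    proof -
      have "b \<otimes> x = (b \<otimes> g) \<otimes> a"
        using a b g by (simp add: m_assoc)
      also have "\<dots> = x \<otimes> inv b"
        using a b g A_comm[of a "inv b"] by (simp add: swap m_assoc)
      finally have "b = inv b"
        using b x by simp
      then have "b \<otimes> b = \<one>"
        using b by (metis A.mem_carrier r_inv)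
      then show ?thesis
        using b by (simp add: T_def numeral_2_eq_2)
    qed
    have "centralizer G x \<subseteq> T \<union> (\<lambda>t. x \<otimes> t) ` T"
    proof
      fix y assume "y \<in> centralizer G x"
      then have y: "y \<in> carrier G" "y \<otimes> x = x \<otimes> y"
        by (auto simp: centralizer_def)
      show "y \<in> T \<union> (\<lambda>t. x \<otimes> t) ` T"
      proof (cases "y \<in> A")
        case True
        then show ?thesis using C_A y by blast
      next
        case False
        then obtain b where b: "b \<in> A" "y = g \<otimes> b"
          using decomp[OF y(1)] by blast
        \<comment> \<open>This is \<open>inv x \<otimes> y\<close> with the factors \<open>g\<close>
          cancelled: it visibly lies in \<open>A\<close>, and it commutes with \<open>x\<close>
          because \<open>y\<close> does.\<close>
        let ?t = "inv a \<otimes> b"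
        have yt: "y = x \<otimes> ?t"
          using a b g by (simp add: m_assoc inv_cancel_left)
        have "x \<otimes> ?t \<otimes> x = x \<otimes> (x \<otimes> ?t)"
          by (simp only: yt[symmetric] y(2))
        then have "x \<otimes> (?t \<otimes> x) = x \<otimes> (x \<otimes> ?t)"
          using a b x by (simp add: m_assoc)
        then have "?t \<otimes> x = x \<otimes> ?t"
          using a b x by simp
        then have "?t \<in> T"
          using C_A a b by blast
        then show ?thesis
          using yt by blast
      qed
    qed
    moreover have "card (T \<union> (\<lambda>t. x \<otimes> t) ` T) \<le> card T + card T"
      using card_Un_le[of T "(\<lambda>t. x \<otimes> t) ` T"] card_image_le[OF \<open>finite T\<close>, of "\<lambda>t. x \<otimes> t"]
      by linarith
    ultimately show ?thesis
      using \<open>finite T\<close> by (meson card_mono finite_UnI finite_imageI finite_subset order_trans)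
  qed
  then show ?thesis by blast
qed

text \<open>The cosets form an image of the centraliser, so there are at most as many of them as it
  has elements. The bound is raised to \<open>Suc n\<close> because \<open>bci_group\<close> asks
  for a positive one.\<close>

lemma bounded_centralizers_imp_bci_group:
  assumes "\<exists>n::nat. \<forall>x\<in>carrier G. \<not> (generate G {x} \<lhd> G) \<longrightarrow>
               finite (centralizer G x) \<and> card (centralizer G x) \<le> n"
  shows "bci_group G"
proof -
  obtain n :: nat where n: "\<And>x. x \<in> carrier G \<Longrightarrow> \<not> (generate G {x} \<lhd> G) \<Longrightarrow>
      finite (centralizer G x) \<and> card (centralizer G x) \<le> n"
    using assms by blast
  have rcosets: "rcosets\<^bsub>G\<lparr>carrier := C\<rparr>\<^esub> H = (\<lambda>a. H #>\<^bsub>G\<lparr>carrier := C\<rparr>\<^esub> a) ` C" for C H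
    by (auto simp: RCOSETS_def)
  have "finite (rcosets\<^bsub>G\<lparr>carrier := centralizer G x\<rparr>\<^esub> (generate G {x})) \<and>
      card (rcosets\<^bsub>G\<lparr>carrier := centralizer G x\<rparr>\<^esub> (generate G {x})) \<le> Suc n"
    if "x \<in> carrier G" "\<not> (generate G {x} \<lhd> G)" for x
    unfolding rcosets using n[OF that]
    by (meson card_image_le finite_imageI le_SucI order_trans)
  then show ?thesis
    unfolding bci_group_def using group_axioms by blast
qed

lemma comm_group_generate_normal:
  assumes "comm_group G" "x \<in> carrier G"
  shows "generate G {x} \<lhd> G"
  using assms by (intro comm_group.subgroup_imp_normal generate_is_subgroup) simp_all

end

theorem theorem4p3:
  fixes G :: "('a, 'b) monoid_scheme" (structure)
  assumes "group G"
    and "non_periodic G"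
  shows "(bci_group G \<longleftrightarrow>
            (\<exists>n::nat. \<forall>x\<in>carrier G. \<not> (generate G {x} \<lhd> G) \<longrightarrow>
               finite (centralizer G x) \<and> card (centralizer G x) \<le> n))
       \<and> ((\<exists>n::nat. \<forall>x\<in>carrier G. \<not> (generate G {x} \<lhd> G) \<longrightarrow>
               finite (centralizer G x) \<and> card (centralizer G x) \<le> n) \<longleftrightarrow>
            (comm_group G \<or>
             (\<exists>A g. subgroup A G \<and> comm_group (G\<lparr>carrier := A\<rparr>) \<and>
                non_periodic (G\<lparr>carrier := A\<rparr>) \<and> two_rank (G\<lparr>carrier := A\<rparr>) < \<infinity> \<and>
                g \<in> carrier G \<and> group.ord G g \<noteq> 0 \<and> group.ord G g \<le> 4 \<and>
                g [^] (2::nat) \<in> A \<and>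
                (\<forall>a\<in>A. inv g \<otimes> a \<otimes> g = inv a) \<and>
                carrier G = generate G (insert g A))))"
proof -
  interpret group G by fact
  let ?ii = "\<exists>n::nat. \<forall>x\<in>carrier G. \<not> (generate G {x} \<lhd> G) \<longrightarrow>
               finite (centralizer G x) \<and> card (centralizer G x) \<le> n"
  \<comment> \<open>All cyclic subgroups of an abelian group are normal, so the bound holds
    vacuously.\<close>
  have 1: ?ii if "comm_group G"
    using comm_group_generate_normal[OF that] by blast
  have 2: ?ii if "subgroup A G" "comm_group (G\<lparr>carrier := A\<rparr>)" "two_rank (G\<lparr>carrier := A\<rparr>) < \<infinity>"
    "g \<in> carrier G" "g [^] (2::nat) \<in> A" "\<forall>a\<in>A. inv g \<otimes> a \<otimes> g = inv a"
    "carrier G = generate G (insert g A)" for A g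
    using generalized_dihedral_centralizer_bound[OF that(1-5) _ that(7)] that(6) by blast
  note 3 = bounded_centralizers_imp_bci_group
  note 4 = bci_group_imp_generalized_dihedral[OF _ \<open>non_periodic G\<close>]
  show ?thesis
    \<comment> \<open>Both equivalences follow from the cycle (iii) to (ii) by \<open>1\<close> and
      \<open>2\<close>, (ii) to (i) by \<open>3\<close>, and (i) to (iii) by
      \<open>4\<close>.\<close>
    by (intro conjI iffI; (elim disjE exE conjE)?) (use 1 2 3 4 in blast)+
qed

end
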